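(* Let $(X,T)$ and $(Y,S)$ be minimal systems. Suppose that $\phi:(X',T)\to(X,T)$ is a proximal extension with $(X',T)$ minimal. If $X$ and $Y$ are quasi-disjoint, then $X'$ and $Y$ are quasi-disjoint.
   Context: A system $(X,T)$ is a compact metric space $X$ with a homeomorphism $T:X\to X$. It is minimal if every orbit $\{T^nx:n\in\mathbb Z\}$ is dense. A factor map (homomorphism, extension) $\pi:(X,T)\to(Y,S)$ is a continuous surjection with $\pi\circ T=S\circ\pi$. A pair $(x,y)$ is proximal if $\inf_{n\in\mathbb Z}\rho(T^nx,T^ny)=0$; an extension $\pi$ is proximal if any $x_1,x_2$ with $\pi(x_1)=\pi(x_2)$ are proximal. A system is equicontinuous if for every $\epsilon>0$ there is $\delta>0$ such that $\rho(x,y)<\delta$ implies $\rho(T^nx,T^ny)<\epsilon$ for all $n\in\mathbb Z$. For a minimal system $(X,T)$, $\pi_X:X\to X_{eq}$ denotes its maximal equicontinuous factor (every factor map from $X$ to an equicontinuous system factors through $\pi_X$). A joining of $(X,T)$ and $(Y,S)$ is a closed $T\times S$-invariant subset of $X\times Y$ with full projections onto $X$ and onto $Y$. Minimal systems $(X,T)$, $(Y,S)$ are quasi-disjoint if $X\times Y$ is the only joining $J$ of $X$ and $Y$ satisfying $(\pi_X\times\pi_Y)(J)=X_{eq}\times Y_{eq}$. *)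

theory Defs
  imports "HOL-Analysis.Analysis"
begin

text \<open>A system is given by a carrier set in a metric space and a map on the ambient type. Only the
  values of the map on the carrier matter.\<close>

definition dynamical_system :: "'a::metric_space set \<Rightarrow> ('a \<Rightarrow> 'a) \<Rightarrow> bool" where
  "dynamical_system X T \<longleftrightarrow> compact X \<and> (\<exists>T'. homeomorphism X X T T')"

text \<open>\<open>iter X T n\<close> is the \<open>n\<close>-th power, for an integer \<open>n\<close>, of the bijection of \<open>X\<close> that \<open>T\<close>
  induces.\<close>

definition iter :: "'a set \<Rightarrow> ('a \<Rightarrow> 'a) \<Rightarrow> int \<Rightarrow> 'a \<Rightarrow> 'a" where
  "iter X T n = (if n \<ge> 0 then T ^^ nat n else inv_into X T ^^ nat (- n))"

definition minimal_system :: "'a::metric_space set \<Rightarrow> ('a \<Rightarrow> 'a) \<Rightarrow> bool" where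
  "minimal_system X T \<longleftrightarrow> dynamical_system X T \<and>
     (\<forall>x\<in>X. closure (range (\<lambda>n. iter X T n x)) = X)"

definition factor_map ::
  "'a::metric_space set \<Rightarrow> ('a \<Rightarrow> 'a) \<Rightarrow> 'b::metric_space set \<Rightarrow> ('b \<Rightarrow> 'b) \<Rightarrow> ('a \<Rightarrow> 'b) \<Rightarrow> bool" where
  "factor_map X T Y S p \<longleftrightarrow>
     continuous_on X p \<and> p ` X = Y \<and> (\<forall>x\<in>X. p (T x) = S (p x))"

definition proximal_pair :: "'a::metric_space set \<Rightarrow> ('a \<Rightarrow> 'a) \<Rightarrow> 'a \<Rightarrow> 'a \<Rightarrow> bool" where
  "proximal_pair X T x y \<longleftrightarrow> (INF n. dist (iter X T n x) (iter X T n y)) = 0"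

definition proximal_extension ::
  "'a::metric_space set \<Rightarrow> ('a \<Rightarrow> 'a) \<Rightarrow> 'b::metric_space set \<Rightarrow> ('b \<Rightarrow> 'b) \<Rightarrow> ('a \<Rightarrow> 'b) \<Rightarrow> bool" where
  "proximal_extension X T Y S p \<longleftrightarrow> factor_map X T Y S p \<and>
     (\<forall>x1\<in>X. \<forall>x2\<in>X. p x1 = p x2 \<longrightarrow> proximal_pair X T x1 x2)"

definition equicontinuous_system :: "'a::metric_space set \<Rightarrow> ('a \<Rightarrow> 'a) \<Rightarrow> bool" where
  "equicontinuous_system X T \<longleftrightarrow> dynamical_system X T \<and>
     (\<forall>\<epsilon>>0. \<exists>\<delta>>0. \<forall>x\<in>X. \<forall>y\<in>X. dist x y < \<delta> \<longrightarrow>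
        (\<forall>n. dist (iter X T n x) (iter X T n y) < \<epsilon>))"

text \<open>A definition cannot quantify over all types, so the universal property is tested on systems
  carried by subsets of the metric space \<open>nat \<Rightarrow> real\<close>, which carries the product topology. This
  is no restriction, because every compact metric space embeds in it and equicontinuity does not
  depend on the choice of a compatible metric: see \<open>maximal_equicontinuous_factor_universal\<close> below.\<close>

definition maximal_equicontinuous_factor ::
  "'a::metric_space set \<Rightarrow> ('a \<Rightarrow> 'a) \<Rightarrow> 'b::metric_space set \<Rightarrow> ('b \<Rightarrow> 'b) \<Rightarrow> ('a \<Rightarrow> 'b) \<Rightarrow> bool" where
  "maximal_equicontinuous_factor X T Z R p \<longleftrightarrow>
     equicontinuous_system Z R \<and> factor_map X T Z R p \<and>
     (\<forall>(W :: (nat \<Rightarrow> real) set) Q q.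
        equicontinuous_system W Q \<and> factor_map X T W Q q \<longrightarrow>
        (\<exists>h. factor_map Z R W Q h \<and> (\<forall>x\<in>X. q x = h (p x))))"

definition joining ::
  "'a::metric_space set \<Rightarrow> ('a \<Rightarrow> 'a) \<Rightarrow> 'b::metric_space set \<Rightarrow> ('b \<Rightarrow> 'b) \<Rightarrow> ('a \<times> 'b) set \<Rightarrow> bool" where
  "joining X T Y S J \<longleftrightarrow> J \<subseteq> X \<times> Y \<and> closed J \<and> map_prod T S ` J = J \<and> fst ` J = X \<and> snd ` J = Y"

text \<open>The arguments \<open>pX : X \<rightarrow> Xeq\<close> and \<open>pY : Y \<rightarrow> Yeq\<close> are meant to be the maximal
  equicontinuous factors of the two systems.\<close>

definition quasi_disjoint ::
  "'a::metric_space set \<Rightarrow> ('a \<Rightarrow> 'a) \<Rightarrow> 'c set \<Rightarrow> ('a \<Rightarrow> 'c) \<Rightarrow>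
   'b::metric_space set \<Rightarrow> ('b \<Rightarrow> 'b) \<Rightarrow> 'd set \<Rightarrow> ('b \<Rightarrow> 'd) \<Rightarrow> bool" where
  "quasi_disjoint X T Xeq pX Y S Yeq pY \<longleftrightarrow>
     {J. joining X T Y S J \<and> map_prod pX pY ` J = Xeq \<times> Yeq} = {X \<times> Y}"

lemma dynamical_system_bij:
  assumes "dynamical_system X T"
  shows "bij_betw T X X"
proof -
  obtain T' where "homeomorphism X X T T'"
    using assms by (auto simp: dynamical_system_def)
  then show ?thesis
    by (intro bij_betw_byWitness[where f' = T']) (auto simp: homeomorphism_def)
qed

lemma iter_in:
  assumes "bij_betw T X X" "x \<in> X"
  shows "iter X T n x \<in> X"
proof -
  have "(T ^^ k) x \<in> X" for k
    using assms by (induction k) (auto simp: bij_betw_def)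
  moreover have "(inv_into X T ^^ k) x \<in> X" for k
    using assms by (induction k) (auto simp: bij_betw_def inv_into_into)
  ultimately show ?thesis
    by (simp add: iter_def)
qed

lemma iter_equivariant:
  assumes T: "bij_betw T X X" and S: "bij_betw S Y Y" and pX: "p ` X \<subseteq> Y"
    and eq: "\<And>x. x \<in> X \<Longrightarrow> p (T x) = S (p x)" and x: "x \<in> X"
  shows "p (iter X T n x) = iter Y S n (p x)"
proof -
  have fwd: "(T ^^ k) x \<in> X \<and> p ((T ^^ k) x) = (S ^^ k) (p x)" for k
    using x T eq by (induction k) (auto simp: bij_betw_def)
  have inv: "p (inv_into X T z) = inv_into Y S (p z)" if "z \<in> X" for z
  proof -
    have *: "inv_into X T z \<in> X" "T (inv_into X T z) = z"
      using T that by (auto simp: bij_betw_def inv_into_into f_inv_into_f)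
    then have "S (p (inv_into X T z)) = p z"
      using eq by metis
    moreover have "p (inv_into X T z) \<in> Y"
      using * pX by auto
    ultimately show ?thesis
      using S by (metis bij_betw_def inv_into_f_f)
  qed
  have "(inv_into X T ^^ k) x \<in> X \<and> p ((inv_into X T ^^ k) x) = (inv_into Y S ^^ k) (p x)" for k
    using x T inv by (induction k) (auto simp: bij_betw_def inv_into_into)
  with fwd show ?thesis
    by (simp add: iter_def)
qed

lemma compact_embeds_in_sequences:
  fixes W :: "'w::metric_space set"
  assumes "compact W"
  obtains e :: "'w \<Rightarrow> nat \<Rightarrow> real" and e' where "homeomorphism W (e ` W) e e'"
proof (cases "W = {}")
  case True
  then show ?thesis
    using that[of "\<lambda>_ _. 0"] by (simp add: homeomorphism_def)
next
  case False
  have "\<exists>K. finite K \<and> K \<subseteq> W \<and> W \<subseteq> (\<Union>x\<in>K. ball x (1 / real (Suc n)))" for n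
    using assms compact_eq_seq_compact_metric seq_compact_imp_totally_bounded[of W] by force
  then obtain K where K: "\<And>n. finite (K n) \<and> K n \<subseteq> W \<and> W \<subseteq> (\<Union>x\<in>K n. ball x (1 / real (Suc n)))"
    by metis
  define D where "D = (\<Union>n. K n)"
  have "countable D"
    using K unfolding D_def by (intro countable_UN) (auto intro: countable_finite)
  moreover have "D \<noteq> {}"
    using K[of 0] False unfolding D_def by auto
  ultimately obtain d :: "nat \<Rightarrow> 'w" where d: "range d = D"
    by (metis range_from_nat_into)
  define e :: "'w \<Rightarrow> nat \<Rightarrow> real" where "e = (\<lambda>x n. dist x (d n))"
  have cont: "continuous_on W e"
    unfolding e_def by (intro continuous_on_coordinatewise_then_product continuous_intros)
  have "inj_on e W"
  proof (rule inj_onI, rule ccontr)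
    fix x y assume xy: "x \<in> W" "y \<in> W" "e x = e y" "x \<noteq> y"
    then obtain n where n: "1 / real (Suc n) < dist x y / 2"
      by (metis nat_approx_posE half_gt_zero zero_less_dist_iff)
    obtain z where z: "z \<in> K n" "dist z x < 1 / real (Suc n)"
      using K[of n] xy(1) by (auto simp: subset_iff)
    then obtain m where "z = d m"
      using d unfolding D_def by (metis UNIV_I UN_I imageE)
    then have "dist x z = dist y z"
      using xy(3) unfolding e_def by metis
    then show False
      using n z dist_triangle[of x y z] by (simp add: dist_commute)
  qed
  then show ?thesis
    using homeomorphism_compact[OF assms cont refl] that by metis
qed

lemma equicontinuous_system_transfer:
  fixes W :: "'w::metric_space set" and V :: "'v::metric_space set"
  assumes W: "equicontinuous_system W Q" and e: "homeomorphism W V e e'"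
  shows "equicontinuous_system V (e \<circ> Q \<circ> e')"
    and "factor_map W Q V (e \<circ> Q \<circ> e') e"
    and "factor_map V (e \<circ> Q \<circ> e') W Q e'"
proof -
  let ?R = "e \<circ> Q \<circ> e'"
  have dW: "dynamical_system W Q"
    using W by (simp add: equicontinuous_system_def)
  then obtain Q' where Q': "homeomorphism W W Q Q'"
    by (auto simp: dynamical_system_def)
  have comp: "compact W" "compact V"
    using dW e by (auto simp: dynamical_system_def homeomorphism_def dest: compact_continuous_image)
  have hR: "homeomorphism V V ?R (e \<circ> (Q' \<circ> e'))"
    using homeomorphism_compose[OF homeomorphism_compose[OF homeomorphism_symD[OF e] Q'] e]
    by (simp add: o_assoc)
  then have dV: "dynamical_system V ?R"
    using comp by (auto simp: dynamical_system_def)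
  show f1: "factor_map W Q V ?R e"
    using e by (auto simp: factor_map_def homeomorphism_def)
  show "factor_map V ?R W Q e'"
    using e Q' by (auto simp: factor_map_def homeomorphism_def)
  have it: "e (iter W Q n x) = iter V ?R n (e x)" if "x \<in> W" for n x
    using f1 that
    by (intro iter_equivariant dynamical_system_bij dW dV) (auto simp: factor_map_def)
  have ucont: "uniformly_continuous_on W e" "uniformly_continuous_on V e'"
    using e comp by (auto simp: homeomorphism_def intro: compact_uniformly_continuous)
  show "equicontinuous_system V ?R"
    unfolding equicontinuous_system_def
  proof (intro conjI dV allI impI)
    fix \<epsilon> :: real assume "\<epsilon> > 0"
    then obtain \<eta> where \<eta>: "\<eta> > 0" "\<And>x y. x \<in> W \<Longrightarrow> y \<in> W \<Longrightarrow> dist x y < \<eta> \<Longrightarrow> dist (e x) (e y) < \<epsilon>"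
      using ucont(1) unfolding uniformly_continuous_on_def by metis
    then obtain \<theta> where \<theta>: "\<theta> > 0" "\<And>x y n. x \<in> W \<Longrightarrow> y \<in> W \<Longrightarrow> dist x y < \<theta> \<Longrightarrow>
        dist (iter W Q n x) (iter W Q n y) < \<eta>"
      using W unfolding equicontinuous_system_def by metis
    then obtain \<delta> where \<delta>: "\<delta> > 0" "\<And>x y. x \<in> V \<Longrightarrow> y \<in> V \<Longrightarrow> dist x y < \<delta> \<Longrightarrow> dist (e' x) (e' y) < \<theta>"
      using ucont(2) unfolding uniformly_continuous_on_def by metis
    have "dist (iter V ?R n x) (iter V ?R n y) < \<epsilon>" if "x \<in> V" "y \<in> V" "dist x y < \<delta>" for x y n
    proof -
      have W': "e' x \<in> W" "e' y \<in> W" "e (e' x) = x" "e (e' y) = y"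
        using e that by (auto simp: homeomorphism_def)
      then have "dist (e (iter W Q n (e' x))) (e (iter W Q n (e' y))) < \<epsilon>"
        using \<eta>(2) \<theta>(2) \<delta>(2) that iter_in[OF dynamical_system_bij[OF dW]] by metis
      then show ?thesis
        using it W' by metis
    qed
    with \<delta>(1) show "\<exists>\<delta>>0. \<forall>x\<in>V. \<forall>y\<in>V. dist x y < \<delta> \<longrightarrow>
        (\<forall>n. dist (iter V ?R n x) (iter V ?R n y) < \<epsilon>)"
      by blast
  qed
qed

lemma factor_map_comp:
  assumes "factor_map X T Y S p" "factor_map Y S Z R q"
  shows "factor_map X T Z R (q \<circ> p)"
  using assms unfolding factor_map_def
  by (auto intro: continuous_on_compose2 simp: image_comp[symmetric])

lemma maximal_equicontinuous_factor_universal: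
  fixes W :: "'w::metric_space set"
  assumes "maximal_equicontinuous_factor X T Z R p"
    and "equicontinuous_system W Q" "factor_map X T W Q q"
  shows "\<exists>h. factor_map Z R W Q h \<and> (\<forall>x\<in>X. q x = h (p x))"
proof -
  have "compact W"
    using assms(2) by (simp add: equicontinuous_system_def dynamical_system_def)
  then obtain e :: "'w \<Rightarrow> nat \<Rightarrow> real" and e' where e: "homeomorphism W (e ` W) e e'"
    by (rule compact_embeds_in_sequences)
  note tr = equicontinuous_system_transfer[OF assms(2) e]
  obtain h where h: "factor_map Z R (e ` W) (e \<circ> Q \<circ> e') h" "\<And>x. x \<in> X \<Longrightarrow> (e \<circ> q) x = h (p x)"
    using assms(1) tr(1) factor_map_comp[OF assms(3) tr(2)]
    unfolding maximal_equicontinuous_factor_def by metis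
  have "q x = (e' \<circ> h) (p x)" if "x \<in> X" for x
    using h(2)[OF that] e assms(3) that
    by (auto simp: homeomorphism_def factor_map_def simp flip: h(2))
  with factor_map_comp[OF h(1) tr(3)] show ?thesis
    by blast
qed

end

theory Submission
  imports Defs
begin

text \<open>Let \<open>J'\<close> be a joining of \<open>X'\<close> and \<open>Y\<close> over \<open>X'eq \<times> Yeq\<close>. Since \<open>piX \<circ> \<phi>\<close> factors through
  \<open>piX'\<close>, the image of \<open>J'\<close> in \<open>X \<times> Y\<close> is a joining over \<open>Xeq \<times> Yeq\<close>, so it is \<open>X \<times> Y\<close>. Fix \<open>x\<close>
  and \<open>y\<close> and choose \<open>a i\<close> with \<open>(a i, y) \<in> J'\<close> in the same \<open>\<phi>\<close>-fibre as the \<open>i\<close>-th iterate of \<open>x\<close>.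
  Finitely many of these pairs can be made close simultaneously, so along some sequence of times
  \<open>y\<close> tends to some \<open>y'\<close>, \<open>x\<close> to some \<open>x'\<close> and each \<open>a i\<close> to the \<open>i\<close>-th iterate of \<open>x'\<close>. Hence \<open>J'\<close>
  contains (orbit of \<open>x'\<close>) \<open>\<times> {y'}\<close>, and by minimality and invariance it is \<open>X' \<times> Y\<close>.\<close>

section \<open>Integer powers of a homeomorphism\<close>

lemma iter_Suc:
  assumes "bij_betw T X X" "x \<in> X"
  shows "iter X T (n + 1) x = T (iter X T n x)"
proof (cases "n \<ge> 0")
  case True
  then have "nat (n + 1) = Suc (nat n)" by simp
  with True show ?thesis by (simp add: iter_def)
next
  case False
  \<comment> \<open>\<open>iter\<close> changes branch at 0: \<open>n + 1\<close> is
    \<open>- int k\<close>, which counts as nonnegative exactly when \<open>k = 0\<close>, hence the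
    case splits on \<open>k\<close> below.\<close>
  then obtain k where n: "n = - int (Suc k)"
    by (metis int_cases linorder_not_le negative_zle nless_le of_nat_0_le_iff)
  have "(inv_into X T ^^ k) x \<in> X"
    using iter_in[OF assms, of "- int k"] assms(2) by (cases "k = 0") (simp_all add: iter_def)
  moreover have "iter X T (n + 1) x = (inv_into X T ^^ k) x"
  proof -
    have "n + 1 = - int k" using n by simp
    then show ?thesis by (cases "k = 0") (simp_all add: iter_def)
  qed
  moreover have "iter X T n x = inv_into X T ((inv_into X T ^^ k) x)"
    unfolding n by (simp add: iter_def del: of_nat_Suc)
  ultimately show ?thesis
    using assms(1) by (simp add: bij_betw_def f_inv_into_f)
qed

lemma iter_add:
  assumes "bij_betw T X X" "x \<in> X"
  shows "iter X T (m + n) x = iter X T m (iter X T n x)"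
proof (induction m rule: int_induct[where k = 0])
  case base
  then show ?case by (simp add: iter_def)
next
  case (step1 i)
  have "iter X T (i + 1 + n) x = iter X T ((i + n) + 1) x"
    by (simp add: algebra_simps)
  then show ?case
    using step1 assms by (simp add: iter_Suc iter_in del: add.assoc)
next
  case (step2 i)
  \<comment> \<open>Downward step: both sides are compared after one more application of
    \<open>T\<close>, which is then cancelled by injectivity on \<open>X\<close>.\<close>
  have "T (iter X T (i - 1 + n) x) = iter X T (i + n) x"
    using iter_Suc[OF assms, of "i - 1 + n"] by (simp add: algebra_simps)
  also have "\<dots> = T (iter X T (i - 1) (iter X T n x))"
    using step2 iter_Suc[OF assms(1) iter_in[OF assms], of "i - 1" n] by simp
  finally show ?case
    using assms by (meson bij_betw_def inj_onD iter_in)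
qed

lemma iter_commute:
  assumes "bij_betw T X X" "x \<in> X"
  shows "iter X T m (iter X T n x) = iter X T n (iter X T m x)"
  by (simp add: add.commute flip: iter_add[OF assms])

lemma continuous_on_funpow:
  assumes "continuous_on X f" "f ` X \<subseteq> X"
  shows "continuous_on X (f ^^ k)"
proof (induction k)
  case 0
  then show ?case by (simp add: id_def)
next
  case (Suc k)
  have "(f ^^ k) ` X \<subseteq> X"
    using assms(2) by (induction k) auto
  then have "continuous_on X (f \<circ> (f ^^ k))"
    by (intro continuous_on_compose Suc.IH continuous_on_subset[OF assms(1)])
  then show ?case by simp
qed

lemma continuous_on_iter:
  assumes "dynamical_system X T"
  shows "continuous_on X (iter X T n)"
proof -
  obtain T' where T': "homeomorphism X X T T'"
    using assms by (auto simp: dynamical_system_def)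
  have inj: "inj_on T X"
    using dynamical_system_bij[OF assms] by (simp add: bij_betw_def)
  \<comment> \<open>On \<open>X\<close> the chosen inverse coincides with the continuous inverse
    \<open>T'\<close>, so negative powers are continuous too.\<close>
  have "inv_into X T x = T' x" if "x \<in> X" for x
    using T' that inj unfolding homeomorphism_def by (metis imageI inv_into_f_f)
  then have "continuous_on X (inv_into X T)" "inv_into X T ` X \<subseteq> X"
    using T' by (auto simp: homeomorphism_def cong: continuous_on_cong)
  with T' show ?thesis
    by (auto simp: iter_def homeomorphism_def intro!: continuous_on_funpow)
qed

lemma tendsto_iter:
  assumes "dynamical_system X T" "\<And>j::nat. x j \<in> X" "l \<in> X" "x \<longlonglongrightarrow> l"
  shows "(\<lambda>j. iter X T n (x j)) \<longlonglongrightarrow> iter X T n l"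
  using continuous_on_tendsto_compose[OF continuous_on_iter[OF assms(1)] assms(4,3)] assms(2)
  by simp

lemma tendsto_dist_transform:
  assumes "(f \<longlongrightarrow> l) F" "((\<lambda>k. dist (g k) (f k)) \<longlongrightarrow> 0) F"
  shows "(g \<longlongrightarrow> l) F"
proof -
  have *: "((\<lambda>k. dist (g k) (f k) + dist (f k) l) \<longlongrightarrow> 0) F"
    using tendsto_add[OF assms(2) iffD1[OF tendsto_dist_iff assms(1)]] by simp
  have "((\<lambda>k. dist (g k) l) \<longlongrightarrow> 0) F"
    by (rule tendsto_sandwich[OF _ _ tendsto_const *]) (auto intro: always_eventually dist_triangle)
  then show ?thesis
    by (simp add: tendsto_dist_iff[of g])
qed

section \<open>Joinings and proximal extensions\<close>

text \<open>The product map permutes \<open>J\<close>, and both projections of \<open>J\<close> are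
  equivariant. Powers taken inside \<open>J\<close>, negative ones included, are therefore computed
  coordinatewise.\<close>

lemma joining_iter:
  assumes "joining X T Y S J" "bij_betw T X X" "bij_betw S Y Y" "(x, y) \<in> J"
  shows "(iter X T n x, iter Y S n y) \<in> J"
proof -
  have J: "J \<subseteq> X \<times> Y" "map_prod T S ` J = J" "fst ` J \<subseteq> X" "snd ` J \<subseteq> Y"
    using assms(1) by (auto simp: joining_def)
  have "inj_on (map_prod T S) J"
    using assms(2,3) J(1) by (auto simp: bij_betw_def intro: inj_on_subset map_prod_inj_on)
  then have b: "bij_betw (map_prod T S) J J"
    using J(2) by (simp add: bij_betw_def)
  let ?z = "iter J (map_prod T S) n (x, y)"
  have "fst ?z = iter X T n x" "snd ?z = iter Y S n y"
    using iter_equivariant[OF b assms(2) J(3) _ assms(4), of n]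
      iter_equivariant[OF b assms(3) J(4) _ assms(4), of n] by auto
  with iter_in[OF b assms(4), of n] show ?thesis
    by (metis prod.collapse)
qed

lemma proximal_pairD:
  assumes "proximal_pair X T x y" "\<delta> > 0"
  obtains n where "dist (iter X T n x) (iter X T n y) < \<delta>"
proof -
  \<comment> \<open>A real \<open>INF\<close> says something about the values only when they are
    bounded below.\<close>
  have "bdd_below (range (\<lambda>n. dist (iter X T n x) (iter X T n y)))"
    by (rule bdd_belowI[where m = 0]) auto
  then have "\<exists>n. dist (iter X T n x) (iter X T n y) < \<delta>"
    using assms cINF_less_iff[of UNIV "\<lambda>n. dist (iter X T n x) (iter X T n y)" \<delta>]
    by (auto simp: proximal_pair_def)
  with that show ?thesis by blast
qed

text \<open>Induction on \<open>I\<close>. Some times \<open>n j\<close> bring the old pairs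
  arbitrarily close. Along a subsequence the new pair tends to \<open>(u, v)\<close>, still in one
  fibre, hence proximal. A fixed further time \<open>m\<close> brings \<open>u\<close> and
  \<open>v\<close> together, and uniform continuity of the \<open>m\<close>-th power keeps the old
  pairs close.\<close>

lemma proximal_extension_simultaneous:
  assumes X: "dynamical_system X T" and Y: "dynamical_system Y S"
    and p: "proximal_extension X T Y S p"
    and I: "finite I" and xs: "\<And>i. i \<in> I \<Longrightarrow> x i \<in> X" and ys: "\<And>i. i \<in> I \<Longrightarrow> y i \<in> X"
    and eq: "\<And>i. i \<in> I \<Longrightarrow> p (x i) = p (y i)" and "\<delta> > 0"
  shows "\<exists>n. \<forall>i\<in>I. dist (iter X T n (x i)) (iter X T n (y i)) < \<delta>"
  using I xs ys eq \<open>\<delta> > 0\<close>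
proof (induction I arbitrary: \<delta> rule: finite_induct)
  case empty
  then show ?case by simp
next
  case (insert k I)
  note b = dynamical_system_bij[OF X]
  have X': "compact X" and f: "factor_map X T Y S p"
    using X p by (auto simp: dynamical_system_def proximal_extension_def)
  have xy: "\<And>i. i \<in> insert k I \<Longrightarrow> x i \<in> X \<and> y i \<in> X"
    using insert.prems by blast
  have "\<forall>j::nat. \<exists>n. \<forall>i\<in>I. dist (iter X T n (x i)) (iter X T n (y i)) < inverse (real (Suc j))"
    using insert by (intro allI insert.IH) auto
  then obtain n where n: "\<And>j i. i \<in> I \<Longrightarrow>
      dist (iter X T (n j) (x i)) (iter X T (n j) (y i)) < inverse (real (Suc j))"
    by metis
  define z where "z = (\<lambda>j. (iter X T (n j) (x k), iter X T (n j) (y k)))"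
  have z: "\<forall>j. z j \<in> X \<times> X"
    using xy[of k] by (auto simp: z_def iter_in[OF b])
  obtain l r where l: "l \<in> X \<times> X" and r: "strict_mono r" "(z \<circ> r) \<longlonglongrightarrow> l"
    using compact_Times[OF X' X'] z unfolding compact_def by metis
  obtain u v where uv: "l = (u, v)" "u \<in> X" "v \<in> X"
    using l by auto
  have lu: "(\<lambda>j. iter X T (n (r j)) (x k)) \<longlonglongrightarrow> u" and lv: "(\<lambda>j. iter X T (n (r j)) (y k)) \<longlonglongrightarrow> v"
    using tendsto_fst[OF r(2)] tendsto_snd[OF r(2)] by (simp_all add: z_def uv(1) o_def)
  have cp: "continuous_on X p"
    using f by (simp add: factor_map_def)
  have "p (iter X T m (x k)) = p (iter X T m (y k))" for m
    using iter_equivariant[OF b dynamical_system_bij[OF Y], of p] f xy[of k] insert.prems(3)[of k]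
    by (simp add: factor_map_def)
  moreover have "(\<lambda>j. p (iter X T (n (r j)) (x k))) \<longlonglongrightarrow> p u"
    using continuous_on_tendsto_compose[OF cp lu uv(2)] xy[of k] by (simp add: iter_in[OF b])
  moreover have "(\<lambda>j. p (iter X T (n (r j)) (y k))) \<longlonglongrightarrow> p v"
    using continuous_on_tendsto_compose[OF cp lv uv(3)] xy[of k] by (simp add: iter_in[OF b])
  ultimately have "p u = p v"
    using LIMSEQ_unique by simp
  then have "proximal_pair X T u v"
    using p uv by (simp add: proximal_extension_def)
  then obtain m where m: "dist (iter X T m u) (iter X T m v) < \<delta>"
    using proximal_pairD insert.prems(4) by metis
  \<comment> \<open>\<open>m\<close> was chosen for the limits \<open>u\<close> and
    \<open>v\<close>; continuity makes it work for the new pair itself at all late times of the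
    subsequence.\<close>
  have "(\<lambda>j. dist (iter X T m (iter X T (n (r j)) (x k))) (iter X T m (iter X T (n (r j)) (y k))))
      \<longlonglongrightarrow> dist (iter X T m u) (iter X T m v)"
    using xy[of k] uv lu lv by (intro tendsto_dist tendsto_iter[OF X]) (auto simp: iter_in[OF b])
  then have ev1: "\<forall>\<^sub>F j in sequentially.
      dist (iter X T m (iter X T (n (r j)) (x k))) (iter X T m (iter X T (n (r j)) (y k))) < \<delta>"
    using m by (rule order_tendstoD)
  have "uniformly_continuous_on X (iter X T m)"
    using continuous_on_iter[OF X] X' by (rule compact_uniformly_continuous)
  then obtain \<eta> where \<eta>: "\<eta> > 0" "\<And>a c. a \<in> X \<Longrightarrow> c \<in> X \<Longrightarrow> dist a c < \<eta> \<Longrightarrow>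
      dist (iter X T m a) (iter X T m c) < \<delta>"
    using insert.prems(4) unfolding uniformly_continuous_on_def by metis
  have "(\<lambda>j. inverse (real (Suc (r j)))) \<longlonglongrightarrow> 0"
    using LIMSEQ_subseq_LIMSEQ[OF LIMSEQ_inverse_real_of_nat r(1)] by (simp add: o_def)
  then have ev2: "\<forall>\<^sub>F j in sequentially. inverse (real (Suc (r j))) < \<eta>"
    using \<eta>(1) by (rule order_tendstoD)
  obtain j where j: "inverse (real (Suc (r j))) < \<eta>"
      "dist (iter X T m (iter X T (n (r j)) (x k))) (iter X T m (iter X T (n (r j)) (y k))) < \<delta>"
    using eventually_happens'[OF sequentially_bot eventually_conj[OF ev1 ev2]] by blast
  have "dist (iter X T m (iter X T (n (r j)) (x i))) (iter X T m (iter X T (n (r j)) (y i))) < \<delta>"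
    if "i \<in> insert k I" for i
  proof (cases "i = k")
    case False
    with that have "i \<in> I" by simp
    then have "dist (iter X T (n (r j)) (x i)) (iter X T (n (r j)) (y i)) < \<eta>"
      using n[of i "r j"] j(1) by linarith
    with \<eta>(2) xy[OF that] show ?thesis
      by (simp add: iter_in[OF b])
  qed (use j(2) in simp)
  then show ?case
    using xy by (intro exI[of _ "m + n (r j)"]) (simp add: iter_add[OF b])
qed

lemma joining_eq_Times_of_proximal_extension:
  assumes X: "minimal_system X T" and Y: "minimal_system Y S" and Z: "dynamical_system Z R"
    and p: "proximal_extension X T Z R p"
    and J: "joining X T Y S J" and full: "map_prod p id ` J = Z \<times> Y"
  shows "J = X \<times> Y"
proof (cases "X = {} \<or> Y = {}")
  case True
  then show ?thesis
    using J by (auto simp: joining_def)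
next
  case False
  then obtain x y where x: "x \<in> X" and y: "y \<in> Y" by auto
  have dX: "dynamical_system X T" and dY: "dynamical_system Y S"
    using X Y by (auto simp: minimal_system_def)
  note bX = dynamical_system_bij[OF dX] and bY = dynamical_system_bij[OF dY]
  have comp: "compact X" "compact Y"
    using dX dY by (auto simp: dynamical_system_def)
  have JXY: "J \<subseteq> X \<times> Y" and cJ: "closed J"
    using J by (auto simp: joining_def)
  have pX: "p ` X = Z"
    using p by (simp add: proximal_extension_def factor_map_def)
  have "\<exists>a. (a, y) \<in> J \<and> p a = p (iter X T i x)" for i
  proof -
    have "(p (iter X T i x), y) \<in> map_prod p id ` J"
      using full pX iter_in[OF bX x] y by auto
    then show ?thesis by auto
  qed
  then obtain a where a: "\<And>i. (a i, y) \<in> J" "\<And>i. p (a i) = p (iter X T i x)"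
    by metis
  have aX: "a i \<in> X" for i
    using a(1) JXY by auto
  \<comment> \<open>The windows exhaust the integers: each fixed \<open>i\<close> lies in all but
    finitely many of them, so one sequence of times serves every \<open>i\<close>.\<close>
  have "\<forall>k::nat. \<exists>n. \<forall>i\<in>{- int k..int k}.
      dist (iter X T n (a i)) (iter X T n (iter X T i x)) < inverse (real (Suc k))"
    using aX a(2) iter_in[OF bX x]
    by (intro allI proximal_extension_simultaneous[OF dX Z p]) auto
  then obtain n where n: "\<And>k i. \<bar>i\<bar> \<le> int k \<Longrightarrow>
      dist (iter X T (n k) (a i)) (iter X T (n k) (iter X T i x)) < inverse (real (Suc k))"
    by (metis abs_le_iff atLeastAtMost_iff minus_le_iff)
  define z where "z = (\<lambda>k. (iter X T (n k) x, iter Y S (n k) y))"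
  have z: "\<forall>k. z k \<in> X \<times> Y"
    using x y by (auto simp: z_def iter_in[OF bX] iter_in[OF bY])
  obtain l r where l: "l \<in> X \<times> Y" and r: "strict_mono r" "(z \<circ> r) \<longlonglongrightarrow> l"
    using compact_Times[OF comp] z unfolding compact_def by metis
  obtain u v where uv: "l = (u, v)" "u \<in> X" "v \<in> Y"
    using l by auto
  have lu: "(\<lambda>k. iter X T (n (r k)) x) \<longlonglongrightarrow> u" and lv: "(\<lambda>k. iter Y S (n (r k)) y) \<longlonglongrightarrow> v"
    using tendsto_fst[OF r(2)] tendsto_snd[OF r(2)] by (simp_all add: z_def uv(1) o_def)
  have inv0: "(\<lambda>k. inverse (real (Suc (r k)))) \<longlonglongrightarrow> 0"
    using LIMSEQ_subseq_LIMSEQ[OF LIMSEQ_inverse_real_of_nat r(1)] by (simp add: o_def)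
  have uvJ: "(iter X T i u, v) \<in> J" for i
  proof -
    \<comment> \<open>Powers commute, so convergence of \<open>x\<close> to \<open>u\<close> along
      these times yields that of its \<open>i\<close>-th iterate to the \<open>i\<close>-th iterate
      of \<open>u\<close>.\<close>
    have "(\<lambda>k. iter X T i (iter X T (n (r k)) x)) \<longlonglongrightarrow> iter X T i u"
      using lu x uv(2) by (intro tendsto_iter[OF dX]) (auto simp: iter_in[OF bX])
    then have 1: "(\<lambda>k. iter X T (n (r k)) (iter X T i x)) \<longlonglongrightarrow> iter X T i u"
      by (simp add: iter_commute[OF bX x])
    have "(\<lambda>k. dist (iter X T (n (r k)) (a i)) (iter X T (n (r k)) (iter X T i x))) \<longlonglongrightarrow> 0"
    proof (rule tendsto_sandwich[OF _ _ tendsto_const inv0])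
      show "\<forall>\<^sub>F k in sequentially.
          dist (iter X T (n (r k)) (a i)) (iter X T (n (r k)) (iter X T i x))
            \<le> inverse (real (Suc (r k)))"
      proof (rule eventually_sequentiallyI[of "nat \<bar>i\<bar>"])
        fix k assume "nat \<bar>i\<bar> \<le> k"
        then have "\<bar>i\<bar> \<le> int (r k)"
          using seq_suble[OF r(1), of k] by linarith
        from n[OF this] show "dist (iter X T (n (r k)) (a i)) (iter X T (n (r k)) (iter X T i x))
            \<le> inverse (real (Suc (r k)))"
          by simp
      qed
    qed simp
    with 1 have "(\<lambda>k. iter X T (n (r k)) (a i)) \<longlonglongrightarrow> iter X T i u"
      by (rule tendsto_dist_transform)
    then have lim: "(\<lambda>k. (iter X T (n (r k)) (a i), iter Y S (n (r k)) y)) \<longlonglongrightarrow> (iter X T i u, v)"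
      using lv by (rule tendsto_Pair)
    show ?thesis
      by (rule closed_sequentially[OF cJ _ lim]) (use joining_iter[OF J bX bY a(1)] in simp)
  qed
  \<comment> \<open>Shifting the first exponent by \<open>- m\<close> beforehand decouples the two
    exponents, so \<open>J\<close> contains a product of two full orbits, each dense by
    minimality.\<close>
  have orb: "(iter X T i u, iter Y S m v) \<in> J" for i m
    using joining_iter[OF J bX bY uvJ[of "- m + i"], of m] iter_add[OF bX uv(2), of m "- m + i"]
    by simp
  have "X \<times> Y = closure (range (\<lambda>i. iter X T i u) \<times> range (\<lambda>m. iter Y S m v))"
    using X Y uv by (simp add: minimal_system_def closure_Times)
  also have "\<dots> \<subseteq> J"
    using orb by (intro closure_minimal cJ) auto
  finally show ?thesis
    using JXY by blast
qed

section \<open>Transfer of quasi-disjointness\<close>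

theorem lemma4p2:
  fixes X :: "'a::metric_space set" and T :: "'a \<Rightarrow> 'a"
    and Y :: "'b::metric_space set" and S :: "'b \<Rightarrow> 'b"
    and X' :: "'c::metric_space set" and T' :: "'c \<Rightarrow> 'c"
    and Xeq :: "'d::metric_space set" and Teq :: "'d \<Rightarrow> 'd" and piX :: "'a \<Rightarrow> 'd"
    and Yeq :: "'e::metric_space set" and Seq :: "'e \<Rightarrow> 'e" and piY :: "'b \<Rightarrow> 'e"
    and X'eq :: "'f::metric_space set" and T'eq :: "'f \<Rightarrow> 'f" and piX' :: "'c \<Rightarrow> 'f"
    and \<phi> :: "'c \<Rightarrow> 'a"
  assumes "minimal_system X T" and "minimal_system Y S" and "minimal_system X' T'"
    and "maximal_equicontinuous_factor X T Xeq Teq piX"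
    and "maximal_equicontinuous_factor Y S Yeq Seq piY"
    and "maximal_equicontinuous_factor X' T' X'eq T'eq piX'"
    and "proximal_extension X' T' X T \<phi>"
    and "quasi_disjoint X T Xeq piX Y S Yeq piY"
  shows "quasi_disjoint X' T' X'eq piX' Y S Yeq piY"
proof -
  have d: "dynamical_system X T" "dynamical_system Y S" "dynamical_system X' T'"
    using assms by (auto simp: minimal_system_def)
  note b = dynamical_system_bij[OF d(1)] dynamical_system_bij[OF d(2)] dynamical_system_bij[OF d(3)]
  have \<phi>: "factor_map X' T' X T \<phi>" and piX: "factor_map X T Xeq Teq piX"
    and eqX: "equicontinuous_system Xeq Teq"
    using assms by (auto simp: proximal_extension_def maximal_equicontinuous_factor_def)
  have im: "\<phi> ` X' = X" "piX ` X = Xeq" "piX' ` X' = X'eq" "piY ` Y = Yeq"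
    using assms by (auto simp: proximal_extension_def maximal_equicontinuous_factor_def factor_map_def)
  \<comment> \<open>\<open>Xeq\<close> has a type of its own, so the universal property is taken in
    its form for arbitrary metric spaces.\<close>
  obtain h where h: "factor_map X'eq T'eq Xeq Teq h" "\<And>x. x \<in> X' \<Longrightarrow> (piX \<circ> \<phi>) x = h (piX' x)"
    using maximal_equicontinuous_factor_universal[OF assms(6) eqX factor_map_comp[OF \<phi> piX]] by blast
  have him: "h ` X'eq = Xeq"
    using h(1) by (simp add: factor_map_def)
  have qd: "J = X \<times> Y" if "joining X T Y S J" "map_prod piX piY ` J = Xeq \<times> Yeq" for J
    using assms(8) that unfolding quasi_disjoint_def by blast
  \<comment> \<open>Quasi-disjointness, being an equality of sets, also asserts that the product is
    a joining. This rules out that just one of \<open>X\<close> and \<open>Y\<close> is empty, as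
    the projections of \<open>X' \<times> Y\<close> require.\<close>
  have "joining X T Y S (X \<times> Y)"
    using assms(8) unfolding quasi_disjoint_def by blast
  then have empty_iff: "X = {} \<longleftrightarrow> Y = {}"
    by (auto simp: joining_def)
  have "joining X' T' Y S (X' \<times> Y)"
    unfolding joining_def
  proof (intro conjI)
    show "closed (X' \<times> Y)"
      using d by (intro closed_Times compact_imp_closed) (auto simp: dynamical_system_def)
    show "map_prod T' S ` (X' \<times> Y) = X' \<times> Y"
      using b by (simp add: map_prod_surj_on bij_betw_def)
    show "fst ` (X' \<times> Y) = X'" "snd ` (X' \<times> Y) = Y"
      using empty_iff im(1) by auto
  qed simp
  moreover have "map_prod piX' piY ` (X' \<times> Y) = X'eq \<times> Yeq"
    using im by (simp add: map_prod_surj_on)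
  moreover have "J = X' \<times> Y"
    if J: "joining X' T' Y S J" and Jeq: "map_prod piX' piY ` J = X'eq \<times> Yeq" for J
  proof -
    have JXY: "J \<subseteq> X' \<times> Y" and cJ: "closed J" and TJ: "map_prod T' S ` J = J"
      and prJ: "fst ` J = X'" "snd ` J = Y"
      using J by (auto simp: joining_def)
    let ?K = "map_prod \<phi> id ` J"
    \<comment> \<open>Compactness of \<open>J\<close> is what makes its continuous image
      \<open>?K\<close> closed.\<close>
    have "compact (X' \<times> Y \<inter> J)"
      using d cJ by (intro compact_Int_closed compact_Times) (auto simp: dynamical_system_def)
    then have "compact J"
      using JXY by (simp add: Int_absorb1)
    moreover have "continuous_on J (map_prod \<phi> id)"
    proof -
      have "continuous_on J (\<lambda>z. \<phi> (fst z))"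
        using \<phi> prJ(1) continuous_on_compose2[OF _ continuous_on_fst[OF continuous_on_id]]
        by (auto simp: factor_map_def)
      then show ?thesis
        unfolding map_prod_def by (simp add: case_prod_beta' continuous_on_Pair continuous_on_snd)
    qed
    ultimately have "closed ?K"
      by (intro compact_imp_closed compact_continuous_image)
    moreover have "map_prod T S ` ?K = ?K"
    proof -
      have "map_prod T S ` ?K = map_prod \<phi> id ` (map_prod T' S ` J)"
        unfolding image_image
        using JXY \<phi> by (intro image_cong) (auto simp: factor_map_def)
      then show ?thesis
        by (simp only: TJ)
    qed
    moreover have "fst ` ?K = \<phi> ` fst ` J" "snd ` ?K = snd ` J"
      by (simp_all add: image_image)
    moreover have "?K \<subseteq> X \<times> Y"
      using JXY im(1) by auto
    ultimately have "joining X T Y S ?K"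
      by (simp only: joining_def prJ im)
    moreover have "map_prod piX piY ` ?K = Xeq \<times> Yeq"
    proof -
      \<comment> \<open>On \<open>X'\<close> the maps \<open>piX \<circ> \<phi>\<close> and
        \<open>h \<circ> piX'\<close> agree, and \<open>h\<close> is onto
        \<open>Xeq\<close>.\<close>
      have "map_prod piX piY ` ?K = map_prod h id ` (map_prod piX' piY ` J)"
        unfolding image_image
        using JXY h(2) by (intro image_cong) auto
      also have "\<dots> = Xeq \<times> Yeq"
        unfolding Jeq using him by (simp add: map_prod_surj_on)
      finally show ?thesis .
    qed
    ultimately have "?K = X \<times> Y"
      by (rule qd)
    then show ?thesis
      by (rule joining_eq_Times_of_proximal_extension[OF assms(3,2) d(1) assms(7) J])
  qed
  ultimately show ?thesis
    unfolding quasi_disjoint_def by blast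
qed

end
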